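(* Let $n\ge1$. For every $d\in[0,n]$ and every $E\subseteq[0,n]$: the sets $\mathrm{hcl}_{n,d}(\underline{E})$ and $\mathrm{Zcl}_{n,d}(\underline{E})$ are symmetric subsets of $\{0,1\}^n$, and, identifying symmetric subsets of $\{0,1\}^n$ with subsets of $[0,n]$, $$\mathrm{hcl}_{n,d}(E)=\mathrm{h^*cl}_{n,d}(E)=\mathrm{Zcl}_{n,d}(E)=\mathrm{Z^*cl}_{n,d}(E)=\overline{L}_{n,d}(E).$$
   Context: For integers $a\le b$, $[a,b]$ denotes the set of integers $t$ with $a\le t\le b$. A subset of $\{0,1\}^n$ is symmetric if it is closed under permutations of coordinates. For $E\subseteq[0,n]$ let $\underline{E}\subseteq\{0,1\}^n$ be the set of points whose Hamming weight lies in $E$, and $\underline{j}=\underline{\{j\}}$; $E\mapsto\underline{E}$ is a bijection between subsets of $[0,n]$ and symmetric subsets of $\{0,1\}^n$, and symmetric sets are identified with subsets of $[0,n]$ through it (e.g. $\mathrm{hcl}_{n,d}(E)$ denotes the subset $F\subseteq[0,n]$ with $\underline{F}=\mathrm{hcl}_{n,d}(\underline{E})$). For $d\in[0,n]$ and $S\subseteq\{0,1\}^n$: $\mathrm{Zcl}_{n,d}(S)$ is the set of all $a\in\{0,1\}^n$ such that $P(a)=0$ for every $P\in\mathbb{R}[X_1,\ldots,X_n]$ of degree at most $d$ (zero polynomial included) vanishing on $S$. Let $\mathscr{H}_n\subseteq\mathbb{R}[X_1,\ldots,X_n]$ be the set of all finite products (including the empty product $1$) of polynomials of degree at most $1$;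 $\mathrm{hcl}_{n,d}(S)$ is the set of all $a\in\{0,1\}^n$ such that $P(a)=0$ for every $P\in\mathscr{H}_n$ of degree at most $d$ vanishing on $S$. For $E\subseteq[0,n]$, $\mathrm{Z^*cl}_{n,d}(E)=\{j\in[0,n]:\underline{j}\subseteq\mathrm{Zcl}_{n,d}(\underline{E})\}$ and $\mathrm{h^*cl}_{n,d}(E)=\{j\in[0,n]:\underline{j}\subseteq\mathrm{hcl}_{n,d}(\underline{E})\}$. For $d\in[0,n]$ and $E=\{t_1<\cdots<t_s\}\subseteq[0,n]$, define $L_{n,d}(E)=E$ if $|E|\le d$, and $L_{n,d}(E)=[0,t_{s-d}]\cup E\cup[t_{d+1},n]$ if $|E|\ge d+1$. With $L_{n,d}^0=\mathrm{id}$ and $L_{n,d}^{k+1}=L_{n,d}\circ L_{n,d}^k$, define $\overline{L}_{n,d}(E)=\bigcup_{k\ge0}L_{n,d}^k(E)$. *)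

theory Defs
  imports Complex_Main "HOL-Library.FuncSet" "HOL-Library.Poly_Mapping"
    "HOL-Combinatorics.Permutations"
begin

text \<open>
  Points of \<open>{0,1}\<^sup>n\<close> are real-valued functions on the coordinates \<open>1, \<dots>, n\<close>, extensional
  (\<open>undefined\<close>) elsewhere, so that two points are equal iff all their coordinates agree.
\<close>

definition cube :: "nat \<Rightarrow> (nat \<Rightarrow> real) set" where
  "cube n = {1..n} \<rightarrow>\<^sub>E {0, 1}"

definition hamming_weight :: "nat \<Rightarrow> (nat \<Rightarrow> real) \<Rightarrow> nat" where
  "hamming_weight n a = card {i \<in> {1..n}. a i = 1}"

definition symmetric :: "nat \<Rightarrow> (nat \<Rightarrow> real) set \<Rightarrow> bool" where
  "symmetric n S \<longleftrightarrow> S \<subseteq> cube n \<and> (\<forall>p a. p permutes {1..n} \<longrightarrow> a \<in> S \<longrightarrow> a \<circ> p \<in> S)"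

definition layers :: "nat \<Rightarrow> nat set \<Rightarrow> (nat \<Rightarrow> real) set" where
  "layers n E = {a \<in> cube n. hamming_weight n a \<in> E}"

text \<open>
  The identification of symmetric subsets of the cube with subsets of \<open>[0,n]\<close>: the inverse of the
  bijection \<^term>\<open>layers n\<close> (see \<open>bij_betw_layers\<close> below). It is meaningful only on symmetric sets.
\<close>

definition weights :: "nat \<Rightarrow> (nat \<Rightarrow> real) set \<Rightarrow> nat set" where
  "weights n S = the_inv_into (Pow {0..n}) (layers n) S"

text \<open>
  A polynomial maps each exponent vector (monomial) to its coefficient; the ring operations are
  those of \<^theory>\<open>HOL-Library.Poly_Mapping\<close>.
\<close>

type_synonym rpoly = "(nat \<Rightarrow>\<^sub>0 nat) \<Rightarrow>\<^sub>0 real"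

definition polys :: "nat \<Rightarrow> rpoly set" where
  "polys n = {P. \<forall>m \<in> Poly_Mapping.keys P. Poly_Mapping.keys m \<subseteq> {1..n}}"

text \<open>
  The zero polynomial gets degree 0, hence it has degree at most \<open>d\<close> for every \<open>d\<close>.
\<close>

definition total_degree :: "rpoly \<Rightarrow> nat" where
  "total_degree P = Max (insert 0
     ((\<lambda>m. \<Sum>i \<in> Poly_Mapping.keys m. Poly_Mapping.lookup m i) ` Poly_Mapping.keys P))"

definition eval_poly :: "rpoly \<Rightarrow> (nat \<Rightarrow> real) \<Rightarrow> real" where
  "eval_poly P a = (\<Sum>m \<in> Poly_Mapping.keys P.
     Poly_Mapping.lookup P m * (\<Prod>i \<in> Poly_Mapping.keys m. a i ^ Poly_Mapping.lookup m i))"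

definition affine_products :: "nat \<Rightarrow> rpoly set" where
  "affine_products n = {prod_list Ps | Ps. \<forall>P \<in> set Ps. P \<in> polys n \<and> total_degree P \<le> 1}"

definition Zcl :: "nat \<Rightarrow> nat \<Rightarrow> (nat \<Rightarrow> real) set \<Rightarrow> (nat \<Rightarrow> real) set" where
  "Zcl n d S = {a \<in> cube n. \<forall>P \<in> polys n.
     total_degree P \<le> d \<longrightarrow> (\<forall>x \<in> S. eval_poly P x = 0) \<longrightarrow> eval_poly P a = 0}"

definition hcl :: "nat \<Rightarrow> nat \<Rightarrow> (nat \<Rightarrow> real) set \<Rightarrow> (nat \<Rightarrow> real) set" where
  "hcl n d S = {a \<in> cube n. \<forall>P \<in> affine_products n.
     total_degree P \<le> d \<longrightarrow> (\<forall>x \<in> S. eval_poly P x = 0) \<longrightarrow> eval_poly P a = 0}"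

definition Zcl_wt :: "nat \<Rightarrow> nat \<Rightarrow> nat set \<Rightarrow> nat set" where
  "Zcl_wt n d E = weights n (Zcl n d (layers n E))"

definition hcl_wt :: "nat \<Rightarrow> nat \<Rightarrow> nat set \<Rightarrow> nat set" where
  "hcl_wt n d E = weights n (hcl n d (layers n E))"

definition Zstar_cl :: "nat \<Rightarrow> nat \<Rightarrow> nat set \<Rightarrow> nat set" where
  "Zstar_cl n d E = {j \<in> {0..n}. layers n {j} \<subseteq> Zcl n d (layers n E)}"

definition hstar_cl :: "nat \<Rightarrow> nat \<Rightarrow> nat set \<Rightarrow> nat set" where
  "hstar_cl n d E = {j \<in> {0..n}. layers n {j} \<subseteq> hcl n d (layers n E)}"

text \<open>
  For \<open>E = {t\<^sub>1 < \<dots> < t\<^sub>s}\<close>, the element \<open>t\<^sub>i\<close> is entry \<open>i - 1\<close> of the sorted list (indexed from 0).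
\<close>

definition L :: "nat \<Rightarrow> nat \<Rightarrow> nat set \<Rightarrow> nat set" where
  "L n d E = (if card E \<le> d then E
     else (let t = (\<lambda>i. sorted_list_of_set E ! (i - 1))
           in {0..t (card E - d)} \<union> E \<union> {t (d + 1)..n}))"

definition L_bar :: "nat \<Rightarrow> nat \<Rightarrow> nat set \<Rightarrow> nat set" where
  "L_bar n d E = (\<Union>k. (L n d ^^ k) E)"

lemma exists_point_of_weight:
  assumes "j \<le> n"
  shows "\<exists>a \<in> cube n. hamming_weight n a = j"
proof
  let ?a = "\<lambda>i. if i \<in> {1..n} then (if i \<le> j then 1 else 0) else (undefined::real)"
  show "?a \<in> cube n" by (auto simp: cube_def PiE_def extensional_def)
  have "{i \<in> {1..n}. ?a i = 1} = {1..j}" using assms by auto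
  then show "hamming_weight n ?a = j" by (simp add: hamming_weight_def)
qed

lemma hamming_weight_le: "hamming_weight n a \<le> n"
proof -
  have "card {i \<in> {1..n}. a i = 1} \<le> card {1..n}" by (rule card_mono) auto
  then show ?thesis by (simp add: hamming_weight_def)
qed

lemma comp_permutes_cube:
  assumes "p permutes {1..n}" "a \<in> cube n"
  shows "a \<circ> p \<in> cube n"
proof (unfold cube_def, rule PiE_I)
  fix i assume "i \<in> {1..n}"
  then have "p i \<in> {1..n}" using permutes_in_image[OF assms(1)] by blast
  then show "(a \<circ> p) i \<in> {0, 1}" using assms(2) unfolding cube_def comp_def by (rule PiE_mem[rotated])
next
  fix i assume "i \<notin> {1..n}"
  then show "(a \<circ> p) i = undefined"
    using assms(2) permutes_not_in[OF assms(1)] PiE_arb unfolding cube_def comp_def by metis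
qed

lemma hamming_weight_comp_permutes:
  assumes "p permutes {1..n}"
  shows "hamming_weight n (a \<circ> p) = hamming_weight n a"
proof -
  have "p ` {i \<in> {1..n}. a (p i) = 1} = {i \<in> {1..n}. a i = 1}" (is "p ` ?A = ?B")
  proof
    show "p ` ?A \<subseteq> ?B" using permutes_in_image[OF assms] by blast
    show "?B \<subseteq> p ` ?A"
    proof
      fix i assume "i \<in> ?B"
      moreover obtain k where "k \<in> {1..n}" "i = p k"
        using calculation permutes_image[OF assms] by blast
      ultimately show "i \<in> p ` ?A" by blast
    qed
  qed
  moreover have "inj_on p ?A" by (rule inj_on_subset[OF permutes_inj[OF assms]]) simp
  then have "card (p ` ?A) = card ?A" by (rule card_image)
  ultimately show ?thesis by (simp add: hamming_weight_def)
qed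

lemma symmetric_layers: "symmetric n (layers n E)"
  using comp_permutes_cube hamming_weight_comp_permutes
  by (auto simp: symmetric_def layers_def)

lemma exists_permutation:
  assumes "a \<in> cube n" "b \<in> cube n" "hamming_weight n a = hamming_weight n b"
  shows "\<exists>p. p permutes {1..n} \<and> a \<circ> p = b"
proof -
  let ?A = "\<lambda>a::nat\<Rightarrow>real. {i \<in> {1..n}. a i = 1}" and ?Z = "\<lambda>a::nat\<Rightarrow>real. {i \<in> {1..n}. a i \<noteq> 1}"
  have z: "?Z c = {1..n} - ?A c" for c by auto
  have cA: "card (?A b) = card (?A a)" using assms(3) by (simp add: hamming_weight_def)
  have "card (?Z c) = n - card (?A c)" for c unfolding z by (subst card_Diff_subset) auto
  with cA have cZ: "card (?Z b) = card (?Z a)" by simp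
  obtain f where f: "bij_betw f (?A b) (?A a)" using cA finite_same_card_bij[of "?A b" "?A a"] by auto
  obtain g where g: "bij_betw g (?Z b) (?Z a)" using cZ finite_same_card_bij[of "?Z b" "?Z a"] by auto
  define p where "p i = (if i \<in> {1..n} then (if b i = 1 then f i else g i) else i)" for i
  have "bij_betw p (?A b) (?A a)" by (rule bij_betw_cong[THEN iffD1, OF _ f]) (auto simp: p_def)
  moreover have "bij_betw p (?Z b) (?Z a)"
    by (rule bij_betw_cong[THEN iffD1, OF _ g]) (auto simp: p_def)
  ultimately have "bij_betw p (?A b \<union> ?Z b) (?A a \<union> ?Z a)"
    by (rule bij_betw_combine) auto
  moreover have "?A c \<union> ?Z c = {1..n}" for c by auto
  ultimately have "bij_betw p {1..n} {1..n}" by simp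
  then have perm: "p permutes {1..n}" by (rule bij_imp_permutes) (auto simp: p_def)
  have "a (p i) = b i" for i
  proof (cases "i \<in> {1..n}")
    case True
    have bi: "b i \<in> {0, 1}" using assms(2) True unfolding cube_def by (rule PiE_mem)
    show ?thesis
    proof (cases "b i = 1")
      case True
      then have "f i \<in> ?A a" using f \<open>i \<in> {1..n}\<close> by (auto dest!: bij_betwE)
      then show ?thesis using True \<open>i \<in> {1..n}\<close> by (simp add: p_def)
    next
      case False
      then have gi: "g i \<in> ?Z a" using g \<open>i \<in> {1..n}\<close> by (auto dest!: bij_betwE)
      then have "g i \<in> {1..n}" by simp
      with assms(1) have "a (g i) \<in> {0, 1}" unfolding cube_def by (rule PiE_mem)
      then show ?thesis using gi bi False \<open>i \<in> {1..n}\<close> by (simp add: p_def)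
    qed
  next
    case False
    then have "p i = i" by (auto simp: p_def)
    then show ?thesis using False assms(1,2) PiE_arb unfolding cube_def by metis
  qed
  then have "a \<circ> p = b" by (simp add: fun_eq_iff)
  then show ?thesis using perm by blast
qed

lemma bij_betw_layers: "bij_betw (layers n) (Pow {0..n}) {S. symmetric n S}"
proof (rule bij_betw_imageI)
  have sub: "E \<subseteq> F" if E: "E \<in> Pow {0..n}" and eq: "layers n E = layers n F" for E F
  proof
    fix j assume j: "j \<in> E"
    with E have "j \<le> n" by auto
    then obtain a where a: "a \<in> cube n" "hamming_weight n a = j"
      using exists_point_of_weight by blast
    then have "a \<in> layers n E" using j by (simp add: layers_def)
    then have "a \<in> layers n F" unfolding eq .
    then show "j \<in> F" using a by (simp add: layers_def)
  qed
  show "inj_on (layers n) (Pow {0..n})"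
  proof (rule inj_onI)
    fix E F assume "E \<in> Pow {0..n}" "F \<in> Pow {0..n}" "layers n E = layers n F"
    then show "E = F" using sub[of E F] sub[of F E] by auto
  qed
  show "layers n ` Pow {0..n} = {S. symmetric n S}"
  proof
    show "layers n ` Pow {0..n} \<subseteq> {S. symmetric n S}" using symmetric_layers by auto
    show "{S. symmetric n S} \<subseteq> layers n ` Pow {0..n}"
    proof clarify
      fix S assume S: "symmetric n S"
      have "S = layers n (hamming_weight n ` S)"
      proof
        show "S \<subseteq> layers n (hamming_weight n ` S)" using S by (auto simp: symmetric_def layers_def)
        show "layers n (hamming_weight n ` S) \<subseteq> S"
        proof
          fix b assume "b \<in> layers n (hamming_weight n ` S)"
          then obtain a where a: "a \<in> S" "b \<in> cube n" "hamming_weight n a = hamming_weight n b"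
            by (auto simp: layers_def)
          moreover have "a \<in> cube n" using a S by (auto simp: symmetric_def)
          ultimately obtain p where "p permutes {1..n}" "a \<circ> p = b"
            using exists_permutation by blast
          then show "b \<in> S" using S a(1) by (auto simp: symmetric_def)
        qed
      qed
      moreover have "hamming_weight n ` S \<in> Pow {0..n}" using hamming_weight_le by auto
      ultimately show "S \<in> layers n ` Pow {0..n}" by blast
    qed
  qed
qed

end

theory Submission
  imports Defs "HOL-Computational_Algebra.Polynomial"
begin

text \<open>
  Since \<open>Zcl \<subseteq> hcl\<close>, it suffices to bound \<open>Zcl\<close> from below and \<open>hcl\<close> from above by the layers of \<open>L_bar\<close>.

  Lower bound: let \<open>P\<close> have degree at most \<open>d\<close> and vanish on \<open>d + 1\<close> layers of weight at least \<open>j\<close>, and let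
  \<open>A\<close> be a \<open>j\<close>-set. The average of \<open>P\<close> over the \<open>v\<close>-subsets \<open>B\<close> of the complement of \<open>A\<close>, evaluated at
  \<open>A \<union> B\<close>, is a univariate polynomial in \<open>v\<close> of degree at most \<open>d\<close> with \<open>d + 1\<close> zeros, so it vanishes at
  \<open>v = 0\<close>, that is, \<open>P\<close> vanishes at \<open>A\<close>. Averaging over the subsets of \<open>A\<close> handles layers of weight at most \<open>j\<close>.

  Upper bound: let \<open>F = L_bar n d E\<close> and let \<open>a\<close> have weight \<open>j \<notin> F\<close>. If \<open>p = |F| - d > 0\<close>, then
  \<open>L n d F \<subseteq> F\<close> forces \<open>[0, p - 1] \<union> [n - p + 1, n] \<subseteq> F\<close>, so \<open>a\<close> has at least \<open>p\<close> ones and \<open>p\<close> zeros. Pairing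
  them up, a product of \<open>p\<close> differences \<open>x\<^sub>u - x\<^sub>v\<close> vanishes on the two outer blocks but not at \<open>a\<close>, and the
  \<open>d - p\<close> remaining weights \<open>t\<close> of \<open>F\<close> are killed by the factors \<open>x\<^sub>1 + \<dots> + x\<^sub>n - t\<close>. If \<open>|F| \<le> d\<close>, the latter
  factors suffice.
\<close>

subsection \<open>The operator \<open>L\<close> and its closure\<close>

text \<open>The element of rank \<open>card E - d\<close> is at least \<open>j\<close> exactly when
  more than \<open>d\<close> elements of \<open>E\<close> are at least \<open>j\<close>; the element
  of rank \<open>d + 1\<close> is treated dually. Counting removes the sorted list and the case
  split: for \<open>card E \<le> d\<close> both added sets are empty. This is the form that the
  averaging argument produces.\<close>

lemma L_eq_card:
  assumes "E \<subseteq> {0..n}"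
  shows "L n d E = E \<union> {j. j \<le> n \<and> d < card {t \<in> E. j \<le> t}} \<union> {j. j \<le> n \<and> d < card {t \<in> E. t \<le> j}}"
proof (cases "card E \<le> d")
  case True
  have "finite E" using assms finite_subset by blast
  then have "card {t \<in> E. Q t} \<le> card E" for Q by (intro card_mono) auto
  then have "\<not> d < card {t \<in> E. Q t}" for Q using True by (meson not_less order_trans)
  then show ?thesis using True by (simp add: L_def)
next
  case False
  have fin: "finite E" using assms finite_subset by blast
  define xs where "xs = sorted_list_of_set E"
  have xs: "sorted xs" "distinct xs" "set xs = E" "length xs = card E"
    using fin by (auto simp: xs_def)
  \<comment> \<open>Counting moves from elements to positions in the sorted list, where the large or
    small elements occupy a final or initial segment.\<close>
  have card_eq: "card {t \<in> E. Q t} = card {i. i < card E \<and> Q (xs ! i)}" for Q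
  proof (rule bij_betw_same_card[symmetric])
    show "bij_betw ((!) xs) {i. i < card E \<and> Q (xs ! i)} {t \<in> E. Q t}"
      using xs by (auto simp: bij_betw_def inj_on_def nth_eq_iff_index_eq in_set_conv_nth)
  qed
  \<comment> \<open>Positions start at 0: exactly \<open>d + 1\<close> of them remain from
    \<open>card E - d - 1\<close> on, and \<open>xs ! d\<close> below is the element of rank
    \<open>d + 1\<close>.\<close>
  have up: "d < card {t \<in> E. j \<le> t} \<longleftrightarrow> j \<le> xs ! (card E - d - 1)" for j
  proof
    assume j: "j \<le> xs ! (card E - d - 1)"
    have "{card E - d - 1..<card E} \<subseteq> {i. i < card E \<and> j \<le> xs ! i}"
      using j xs False by (auto intro: order_trans[OF _ sorted_nth_mono])
    then have "card {card E - d - 1..<card E} \<le> card {i. i < card E \<and> j \<le> xs ! i}"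
      by (intro card_mono) auto
    then show "d < card {t \<in> E. j \<le> t}" using False by (simp add: card_eq)
  next
    assume d: "d < card {t \<in> E. j \<le> t}"
    show "j \<le> xs ! (card E - d - 1)"
    proof (rule ccontr)
      assume j: "\<not> ?thesis"
      have "{i. i < card E \<and> j \<le> xs ! i} \<subseteq> {card E - d..<card E}"
      proof
        fix i assume "i \<in> {i. i < card E \<and> j \<le> xs ! i}"
        then have i: "i < card E" "j \<le> xs ! i" by auto
        show "i \<in> {card E - d..<card E}"
        proof (rule ccontr)
          assume "i \<notin> {card E - d..<card E}"
          then have "xs ! i \<le> xs ! (card E - d - 1)" using xs i by (intro sorted_nth_mono) auto
          then show False using i j by simp
        qed
      qed
      then have "card {i. i < card E \<and> j \<le> xs ! i} \<le> card {card E - d..<card E}"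
        by (intro card_mono) auto
      then show False using d by (simp add: card_eq)
    qed
  qed
  have down: "d < card {t \<in> E. t \<le> j} \<longleftrightarrow> xs ! d \<le> j" for j
  proof
    assume j: "xs ! d \<le> j"
    have "{0..d} \<subseteq> {i. i < card E \<and> xs ! i \<le> j}"
      using j xs False by (auto intro: order_trans[OF sorted_nth_mono])
    then have "card {0..d} \<le> card {i. i < card E \<and> xs ! i \<le> j}"
      by (intro card_mono) auto
    then show "d < card {t \<in> E. t \<le> j}" by (simp add: card_eq)
  next
    assume d: "d < card {t \<in> E. t \<le> j}"
    show "xs ! d \<le> j"
    proof (rule ccontr)
      assume j: "\<not> ?thesis"
      have "{i. i < card E \<and> xs ! i \<le> j} \<subseteq> {0..<d}"
      proof
        fix i assume "i \<in> {i. i < card E \<and> xs ! i \<le> j}"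
        then have i: "i < card E" "xs ! i \<le> j" by auto
        show "i \<in> {0..<d}"
        proof (rule ccontr)
          assume "i \<notin> {0..<d}"
          then have "xs ! d \<le> xs ! i" using xs i by (intro sorted_nth_mono) auto
          then show False using i j by simp
        qed
      qed
      then have "card {i. i < card E \<and> xs ! i \<le> j} \<le> card {0..<d}"
        by (intro card_mono) auto
      then show False using d by (simp add: card_eq)
    qed
  qed
  have "xs ! (card E - d - 1) \<le> n"
    using assms xs False nth_mem[of "card E - d - 1" xs] by fastforce
  then have "{j. j \<le> n \<and> j \<le> xs ! (card E - d - 1)} = {0..xs ! (card E - d - 1)}" by auto
  moreover have "{j. j \<le> n \<and> xs ! d \<le> j} = {xs ! d..n}" by auto
  ultimately show ?thesis using False
    unfolding up down by (auto simp: L_def Let_def xs_def[symmetric])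
qed

lemma L_bar_subset:
  assumes "E \<subseteq> {0..n}"
  shows "L_bar n d E \<subseteq> {0..n}"
proof -
  have "(L n d ^^ k) E \<subseteq> {0..n}" for k
    using assms by (induction k) (auto simp: L_eq_card)
  then show ?thesis by (auto simp: L_bar_def)
qed

text \<open>Induction over the iterates. In the application \<open>Z\<close> is the set of weights
  whose layers are killed by a fixed polynomial, so that one step of \<open>L\<close> is all that
  has to be analysed.\<close>

lemma L_bar_least:
  assumes "E \<subseteq> {0..n}" "E \<subseteq> Z" "\<And>F. F \<subseteq> {0..n} \<Longrightarrow> F \<subseteq> Z \<Longrightarrow> L n d F \<subseteq> Z"
  shows "L_bar n d E \<subseteq> Z"
proof -
  have "(L n d ^^ k) E \<subseteq> Z \<and> (L n d ^^ k) E \<subseteq> {0..n}" for k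
  proof (induction k)
    case (Suc k)
    then have "L n d ((L n d ^^ k) E) \<subseteq> {0..n}" by (auto simp: L_eq_card)
    with Suc assms(3) show ?case by simp
  qed (use assms in auto)
  then show ?thesis by (auto simp: L_bar_def)
qed

lemma subset_L_bar: "E \<subseteq> L_bar n d E"
  unfolding L_bar_def by (rule order_trans[OF _ UN_upper[of 0]]) auto

text \<open>The iterates increase inside the finite set \<open>{0..n}\<close>, so their union
  already equals one of them, and applying \<open>L\<close> to it yields the next iterate.\<close>

lemma L_L_bar:
  assumes E: "E \<subseteq> {0..n}"
  shows "L n d (L_bar n d E) \<subseteq> L_bar n d E"
proof -
  let ?A = "\<lambda>k. (L n d ^^ k) E"
  have sub: "?A k \<subseteq> {0..n}" for k using E by (induction k) (auto simp: L_eq_card)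
  have inc: "?A k \<subseteq> ?A (Suc k)" for k using sub[of k] by (auto simp: L_eq_card)
  have mono: "?A k \<subseteq> ?A l" if "k \<le> l" for k l using lift_Suc_mono_le[of ?A, OF inc that] .
  have "finite (L_bar n d E)" using L_bar_subset[OF E] finite_subset by blast
  then have "\<exists>k. L_bar n d E \<subseteq> ?A k"
  proof (rule finite_subset_induct'[where A = "L_bar n d E"])
    fix j F assume "j \<in> L_bar n d E" "\<exists>k. F \<subseteq> ?A k"
    then obtain k l where "j \<in> ?A l" "F \<subseteq> ?A k" by (auto simp: L_bar_def)
    then have "insert j F \<subseteq> ?A (max k l)"
      using mono[of k "max k l"] mono[of l "max k l"] by auto
    then show "\<exists>k. insert j F \<subseteq> ?A k" by blast
  qed auto
  then obtain k where "L_bar n d E \<subseteq> ?A k" by blast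
  moreover have upper: "?A l \<subseteq> L_bar n d E" for l unfolding L_bar_def by (rule UN_upper) simp
  ultimately have "L_bar n d E = ?A k" by blast
  then have "L n d (L_bar n d E) = ?A (Suc k)" by simp
  then show ?thesis using upper[of "Suc k"] by simp
qed

text \<open>The witness is the truncated difference \<open>p = card F - d\<close>: closedness forces the \<open>p\<close> smallest and
  the \<open>p\<close> largest weights of \<open>{0..n}\<close> into \<open>F\<close>.\<close>

lemma gap_of_L_closed:
  assumes F: "F \<subseteq> {0..n}" and closed: "L n d F \<subseteq> F" and j: "j \<le> n" "j \<notin> F"
  shows "\<exists>p. p \<le> j \<and> j + p \<le> n \<and> p + card {t \<in> F. p \<le> t \<and> t + p \<le> n} \<le> d"
proof (cases "card F \<le> d")
  case True
  have "{t \<in> F. 0 \<le> t \<and> t + 0 \<le> n} = F" using F by auto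
  then show ?thesis using True j by (intro exI[of _ 0]) auto
next
  case False
  have fin: "finite F" using F finite_subset by blast
  define p where "p = card F - d"
  \<comment> \<open>At most \<open>i < p\<close> elements of \<open>F\<close> lie below
    \<open>i\<close>, so more than \<open>card F - p = d\<close> lie at or above it, and
    \<open>L\<close> adjoins \<open>i\<close>.\<close>
  have low: "i \<in> F" if "i < p" "i \<le> n" for i
  proof -
    have "card (F - {0..<i}) \<ge> card F - card {0..<i}" by (rule diff_card_le_card_Diff) simp
    moreover have "F - {0..<i} = {t \<in> F. i \<le> t}" by auto
    ultimately have "d < card {t \<in> F. i \<le> t}" using that by (simp add: p_def)
    then show ?thesis using closed that by (auto simp: L_eq_card[OF F])
  qed
  have high: "i \<in> F" if "n < i + p" "i \<le> n" for i
  proof -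
    have "card (F - {i<..n}) \<ge> card F - card {i<..n}" by (rule diff_card_le_card_Diff) simp
    moreover have "F - {i<..n} = {t \<in> F. t \<le> i}" using F by auto
    ultimately have "d < card {t \<in> F. t \<le> i}" using that by (simp add: p_def)
    then show ?thesis using closed that by (auto simp: L_eq_card[OF F])
  qed
  have pj: "p \<le> j" "j + p \<le> n" using low[of j] high[of j] j by force+
  \<comment> \<open>As \<open>j\<close> is missing from the closed set \<open>F\<close>, at most
    \<open>d\<close> elements of \<open>F\<close> are at most \<open>j\<close>. The weights below
    \<open>p\<close> are among them, whence \<open>p \<le> d\<close>.\<close>
  have "card {t \<in> F. t \<le> j} \<le> d" using closed j by (auto simp: L_eq_card[OF F])
  moreover have "{0..<p} \<subseteq> {t \<in> F. t \<le> j}" using low pj by auto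
  then have "card {0..<p} \<le> card {t \<in> F. t \<le> j}" using fin by (intro card_mono) auto
  ultimately have pd: "p \<le> d" by simp
  have "{t \<in> F. p \<le> t \<and> t + p \<le> n} = F - ({0..<p} \<union> {n - p<..n})" using F pj by auto
  moreover have "{0..<p} \<union> {n - p<..n} \<subseteq> F" using low high pj by auto
  moreover have "card ({0..<p} \<union> {n - p<..n}) = p + p"
    using pj by (subst card_Un_disjoint) auto
  ultimately have "card {t \<in> F. p \<le> t \<and> t + p \<le> n} = card F - (p + p)"
    by (simp add: card_Diff_subset)
  \<comment> \<open>Here \<open>card F = d + p\<close>, so removing the two outer blocks leaves
    \<open>d - p\<close> weights; \<open>p \<le> d\<close> makes the truncated subtraction
    exact.\<close>
  then show ?thesis using pj pd False by (intro exI[of _ p]) (auto simp: p_def)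
qed

subsection \<open>Affine products separating a point from layers\<close>

lemma eval_poly_zero [simp]: "eval_poly 0 a = 0"
  by (simp add: eval_poly_def)

lemma eval_poly_add: "eval_poly (P + Q) a = eval_poly P a + eval_poly Q a"
  unfolding eval_poly_def
  by (rule setsum_keys_plus_distrib[where f = "\<lambda>m c. c * (\<Prod>i \<in> Poly_Mapping.keys m. a i ^ Poly_Mapping.lookup m i)"])
     (auto simp: algebra_simps)

lemma eval_poly_sum: "eval_poly (sum P I) a = (\<Sum>i\<in>I. eval_poly (P i) a)"
  by (induction I rule: infinite_finite_induct) (auto simp: eval_poly_add)

lemma eval_poly_single:
  "eval_poly (Poly_Mapping.single m c) a =
    c * (\<Prod>i \<in> Poly_Mapping.keys m. a i ^ Poly_Mapping.lookup m i)"
  by (cases "c = 0") (auto simp: eval_poly_def)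

lemma sum_singles: "(\<Sum>m\<in>Poly_Mapping.keys P. Poly_Mapping.single m (Poly_Mapping.lookup P m)) = P"
proof (rule poly_mapping_eqI)
  fix k
  show "Poly_Mapping.lookup (\<Sum>m\<in>Poly_Mapping.keys P. Poly_Mapping.single m (Poly_Mapping.lookup P m)) k
      = Poly_Mapping.lookup P k"
    by (cases "k \<in> Poly_Mapping.keys P")
       (auto simp: lookup_sum lookup_single when_def in_keys_iff sum.delta)
qed

text \<open>All three products extend to the union of the two supports, since a variable outside a
  support has exponent 0 and contributes the factor 1.\<close>

lemma prod_keys_plus:
  fixes a :: "nat \<Rightarrow> real" and m m' :: "nat \<Rightarrow>\<^sub>0 nat"
  shows "(\<Prod>i \<in> Poly_Mapping.keys (m + m'). a i ^ Poly_Mapping.lookup (m + m') i) =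
    (\<Prod>i \<in> Poly_Mapping.keys m. a i ^ Poly_Mapping.lookup m i) *
    (\<Prod>i \<in> Poly_Mapping.keys m'. a i ^ Poly_Mapping.lookup m' i)"
proof -
  let ?K = "Poly_Mapping.keys m \<union> Poly_Mapping.keys m'"
  have ext: "(\<Prod>i \<in> Poly_Mapping.keys k. a i ^ Poly_Mapping.lookup k i) = (\<Prod>i \<in> ?K. a i ^ Poly_Mapping.lookup k i)"
    if "Poly_Mapping.keys k \<subseteq> ?K" for k
    using that by (intro prod.mono_neutral_left) (auto simp: in_keys_iff)
  show ?thesis
    unfolding ext[OF keys_add] ext[OF Un_upper1] ext[OF Un_upper2]
    by (simp add: lookup_add power_add prod.distrib)
qed

text \<open>Both sides are bilinear, so expanding the factors by \<open>sum_singles\<close> leaves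
  only products of two monomials.\<close>

lemma eval_poly_mult: "eval_poly (P * Q) a = eval_poly P a * eval_poly Q a"
proof -
  have "P * Q = (\<Sum>m\<in>Poly_Mapping.keys P. \<Sum>m'\<in>Poly_Mapping.keys Q.
      Poly_Mapping.single (m + m') (Poly_Mapping.lookup P m * Poly_Mapping.lookup Q m'))"
    by (subst (1) sum_singles[of P, symmetric], subst (1) sum_singles[of Q, symmetric])
       (simp add: sum_product mult_single)
  then have "eval_poly (P * Q) a = (\<Sum>m\<in>Poly_Mapping.keys P. \<Sum>m'\<in>Poly_Mapping.keys Q.
      eval_poly (Poly_Mapping.single m (Poly_Mapping.lookup P m)) a *
      eval_poly (Poly_Mapping.single m' (Poly_Mapping.lookup Q m')) a)"
    by (simp add: eval_poly_sum eval_poly_single prod_keys_plus mult_ac)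
  also have "\<dots> = eval_poly P a * eval_poly Q a"
    by (simp add: sum_product[symmetric] eval_poly_sum[symmetric] sum_singles)
  finally show ?thesis .
qed

lemma eval_poly_one [simp]: "eval_poly 1 a = 1"
  using eval_poly_single[of 0 1 a] by simp

lemma eval_poly_prod_list: "eval_poly (prod_list Ps) a = (\<Prod>P\<leftarrow>Ps. eval_poly P a)"
  by (induction Ps) (auto simp: eval_poly_mult)

lemma polys_add: "P \<in> polys n \<Longrightarrow> Q \<in> polys n \<Longrightarrow> P + Q \<in> polys n"
  using keys_add[of P Q] by (fastforce simp: polys_def)

lemma polys_sum: "(\<And>i. i \<in> I \<Longrightarrow> P i \<in> polys n) \<Longrightarrow> sum P I \<in> polys n"
  by (induction I rule: infinite_finite_induct) (auto simp: polys_add, auto simp: polys_def)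

lemma polys_mult:
  assumes "P \<in> polys n" "Q \<in> polys n"
  shows "P * Q \<in> polys n"
  unfolding polys_def
proof clarify
  fix m i assume m: "m \<in> Poly_Mapping.keys (P * Q)" and i: "i \<in> Poly_Mapping.keys m"
  then obtain k l where "m = k + l" "k \<in> Poly_Mapping.keys P" "l \<in> Poly_Mapping.keys Q"
    using keys_mult[of P Q] by blast
  then show "i \<in> {1..n}" using keys_add[of k l] i assms unfolding polys_def by blast
qed

lemma polys_prod_list: "(\<And>P. P \<in> set Ps \<Longrightarrow> P \<in> polys n) \<Longrightarrow> prod_list Ps \<in> polys n"
  by (induction Ps) (auto simp: polys_mult, auto simp: polys_def)

lemma total_degree_le_iff:
  "total_degree P \<le> d \<longleftrightarrow>
    (\<forall>m \<in> Poly_Mapping.keys P. (\<Sum>i \<in> Poly_Mapping.keys m. Poly_Mapping.lookup m i) \<le> d)"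
  by (auto simp: total_degree_def)

lemma total_degree_add:
  "total_degree P \<le> d \<Longrightarrow> total_degree Q \<le> d \<Longrightarrow> total_degree (P + Q) \<le> d"
  using keys_add[of P Q] by (fastforce simp: total_degree_le_iff)

lemma total_degree_sum:
  "(\<And>i. i \<in> I \<Longrightarrow> total_degree (P i) \<le> d) \<Longrightarrow> total_degree (sum P I) \<le> d"
  by (induction I rule: infinite_finite_induct) (auto simp: total_degree_add, auto simp: total_degree_def)

lemma total_degree_mult: "total_degree (P * Q) \<le> total_degree P + total_degree Q"
  unfolding total_degree_le_iff
proof
  fix m assume "m \<in> Poly_Mapping.keys (P * Q)"
  then obtain k l where m: "m = k + l" "k \<in> Poly_Mapping.keys P" "l \<in> Poly_Mapping.keys Q"
    using keys_mult[of P Q] by blast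
  have "(\<Sum>i \<in> Poly_Mapping.keys m. Poly_Mapping.lookup m i) =
      (\<Sum>i \<in> Poly_Mapping.keys k. Poly_Mapping.lookup k i) + (\<Sum>i \<in> Poly_Mapping.keys l. Poly_Mapping.lookup l i)"
    unfolding m by (rule setsum_keys_plus_distrib[where f = "\<lambda>i c. c"]) auto
  also have "\<dots> \<le> total_degree P + total_degree Q"
    using m total_degree_le_iff[of P "total_degree P"] total_degree_le_iff[of Q "total_degree Q"]
    by (intro add_mono) auto
  finally show "(\<Sum>i \<in> Poly_Mapping.keys m. Poly_Mapping.lookup m i) \<le> total_degree P + total_degree Q" .
qed

lemma total_degree_prod_list:
  assumes "\<And>P. P \<in> set Ps \<Longrightarrow> total_degree P \<le> 1"
  shows "total_degree (prod_list Ps) \<le> length Ps"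
  using assms
proof (induction Ps)
  case (Cons P Ps)
  have "total_degree (P * prod_list Ps) \<le> total_degree P + total_degree (prod_list Ps)"
    by (rule total_degree_mult)
  also have "\<dots> \<le> 1 + length Ps" using Cons by (intro add_mono) auto
  finally show ?case by simp
qed (auto simp: total_degree_def)

section \<open>Variables, constants and the two kinds of affine factor\<close>

definition var :: "nat \<Rightarrow> rpoly" where
  "var i = Poly_Mapping.single (Poly_Mapping.single i 1) 1"

lemma eval_poly_var [simp]: "eval_poly (var i) a = a i"
  by (simp add: var_def eval_poly_single)

lemma eval_poly_const [simp]: "eval_poly (Poly_Mapping.single 0 c) a = c"
  by (simp add: eval_poly_single)

lemma var_in_polys: "i \<in> {1..n} \<Longrightarrow> var i \<in> polys n"
  by (simp add: var_def polys_def)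

lemma const_in_polys: "Poly_Mapping.single 0 c \<in> polys n"
  by (simp add: polys_def)

lemma total_degree_var: "total_degree (var i) \<le> 1"
  by (simp add: var_def total_degree_le_iff)

lemma total_degree_const: "total_degree (Poly_Mapping.single 0 c) \<le> d"
  by (simp add: total_degree_le_iff)

lemma eval_poly_diff: "eval_poly (P - Q) a = eval_poly P a - eval_poly Q a"
  using eval_poly_add[of "P - Q" Q a] by simp

lemma polys_diff: "P \<in> polys n \<Longrightarrow> Q \<in> polys n \<Longrightarrow> P - Q \<in> polys n"
  using keys_diff[of P Q] by (fastforce simp: polys_def)

lemma total_degree_diff:
  "total_degree P \<le> d \<Longrightarrow> total_degree Q \<le> d \<Longrightarrow> total_degree (P - Q) \<le> d"
  using keys_diff[of P Q] by (fastforce simp: total_degree_le_iff)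

text \<open>On the cube this affine form vanishes exactly on the layer of weight
  \<open>t\<close>.\<close>

definition weight_factor :: "nat \<Rightarrow> nat \<Rightarrow> rpoly" where
  "weight_factor n t = (\<Sum>i\<in>{1..n}. var i) + Poly_Mapping.single 0 (- real t)"

definition diff_factor :: "nat \<Rightarrow> nat \<Rightarrow> rpoly" where
  "diff_factor u v = var u - var v"

lemma weight_factor_affine: "weight_factor n t \<in> polys n \<and> total_degree (weight_factor n t) \<le> 1"
  unfolding weight_factor_def
  by (intro conjI polys_add total_degree_add polys_sum total_degree_sum const_in_polys
      total_degree_const var_in_polys total_degree_var)

lemma diff_factor_affine:
  assumes "u \<in> {1..n}" "v \<in> {1..n}"
  shows "diff_factor u v \<in> polys n \<and> total_degree (diff_factor u v) \<le> 1"
  unfolding diff_factor_def using assms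
  by (intro conjI polys_diff total_degree_diff var_in_polys total_degree_var)

lemma sum_cube:
  assumes "a \<in> cube n"
  shows "(\<Sum>i\<in>{1..n}. a i) = real (hamming_weight n a)"
proof -
  have "(\<Sum>i\<in>{1..n}. a i) = (\<Sum>i\<in>{1..n}. if a i = 1 then 1 else 0)"
    using assms by (intro sum.cong) (auto simp: cube_def PiE_iff)
  also have "\<dots> = real (card ({1..n} \<inter> {i. a i = 1}))"
    by (simp add: sum.If_cases)
  also have "{1..n} \<inter> {i. a i = 1} = {i \<in> {1..n}. a i = 1}" by auto
  finally show ?thesis by (simp add: hamming_weight_def)
qed

lemma eval_weight_factor:
  "a \<in> cube n \<Longrightarrow> eval_poly (weight_factor n t) a = real (hamming_weight n a) - real t"
  using sum_cube[of a n] by (simp add: weight_factor_def eval_poly_add eval_poly_sum)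

lemma eval_diff_factor [simp]: "eval_poly (diff_factor u v) a = a u - a v"
  by (simp add: diff_factor_def eval_poly_diff)

text \<open>Every affine product lies in \<open>polys n\<close>, so \<open>hcl\<close> tests against
  fewer polynomials.\<close>

lemma Zcl_subset_hcl: "Zcl n d S \<subseteq> hcl n d S"
proof -
  have "affine_products n \<subseteq> polys n"
    by (auto simp: affine_products_def intro!: polys_prod_list)
  then show ?thesis by (auto simp: Zcl_def hcl_def)
qed

text \<open>Picking from each pair the coordinate carrying a one, respectively a zero, gives \<open>p\<close> distinct
  ones and \<open>p\<close> distinct zeros.\<close>

lemma weight_bounds_of_pairs:
  fixes u v :: "nat \<Rightarrow> nat"
  assumes x: "x \<in> cube n"
    and u: "inj_on u {..<p}" "u ` {..<p} \<subseteq> {1..n}" and v: "inj_on v {..<p}" "v ` {..<p} \<subseteq> {1..n}"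
    and disj: "u ` {..<p} \<inter> v ` {..<p} = {}"
    and ne: "\<And>i. i < p \<Longrightarrow> x (u i) \<noteq> x (v i)"
  shows "p \<le> hamming_weight n x \<and> hamming_weight n x + p \<le> n"
proof -
  \<comment> \<open>\<open>w True i\<close> is the coordinate of pair \<open>i\<close> that carries
    a one, \<open>w False i\<close> the one that carries a zero.\<close>
  define w where "w b i = (if (x (u i) = 1) = b then u i else v i)" for b i
  have val: "x i \<in> {0, 1}" if "i \<in> {1..n}" for i using x that by (auto simp: cube_def PiE_iff)
  have inj: "inj_on (w b) {..<p}" for b
  proof (rule inj_onI)
    fix i j assume "i \<in> {..<p}" "j \<in> {..<p}" "w b i = w b j"
    then show "i = j" using u(1) v(1) disj
      by (auto simp: w_def inj_on_def split: if_splits)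
  qed
  have mem: "w b i \<in> {1..n} \<and> (x (w b i) = 1) = b" if "i < p" for b i
  proof -
    have uv: "u i \<in> {1..n}" "v i \<in> {1..n}" using u v that by auto
    then have "x (u i) \<in> {0, 1}" "x (v i) \<in> {0, 1}" using val by blast+
    then have "(x (v i) = 1) = (x (u i) \<noteq> 1)" using ne[OF that] by auto
    then show ?thesis using uv by (cases b) (simp_all add: w_def)
  qed
  have card: "p \<le> card {i \<in> {1..n}. (x i = 1) = b}" for b
  proof -
    have "w b ` {..<p} \<subseteq> {i \<in> {1..n}. (x i = 1) = b}" using mem by blast
    then have "card {..<p} \<le> card {i \<in> {1..n}. (x i = 1) = b}"
      by (intro card_inj_on_le[OF inj]) auto
    then show ?thesis by simp
  qed
  have "card {i \<in> {1..n}. (x i = 1) = False} = card ({1..n} - {i \<in> {1..n}. x i = 1})"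
    by (rule arg_cong[where f = card]) auto
  also have "\<dots> = card {1..n} - card {i \<in> {1..n}. x i = 1}" by (rule card_Diff_subset) auto
  finally have "p \<le> n - hamming_weight n x" using card[of False] by (simp add: hamming_weight_def)
  moreover have "p \<le> hamming_weight n x" using card[of True] by (simp add: hamming_weight_def)
  ultimately show ?thesis using hamming_weight_le[of n x] by simp
qed

text \<open>The coordinates \<open>u i\<close> are ones of \<open>a\<close> and the
  \<open>v i\<close> are zeros, so every difference equals 1 at \<open>a\<close>. A point of weight
  below \<open>p\<close> or above \<open>n - p\<close> cannot separate all \<open>p\<close> pairs,
  and the remaining weights of \<open>F\<close> receive one weight factor each. The hypothesis on
  \<open>d\<close> counts these factors.\<close>

lemma affine_product_separates:
  assumes F: "finite F" and a: "a \<in> cube n" "hamming_weight n a \<notin> F"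
    and p: "p \<le> hamming_weight n a" "hamming_weight n a + p \<le> n"
    and d: "p + card {t \<in> F. p \<le> t \<and> t + p \<le> n} \<le> d"
  shows "\<exists>P \<in> affine_products n. total_degree P \<le> d \<and>
    (\<forall>x \<in> layers n F. eval_poly P x = 0) \<and> eval_poly P a \<noteq> 0"
proof -
  let ?S = "{i \<in> {1..n}. a i = 1}"
  have "p \<le> card ?S" using p by (simp add: hamming_weight_def)
  then obtain U where U: "U \<subseteq> ?S" "card U = p" "finite U" by (meson obtain_subset_with_card_n)
  have "card ({1..n} - ?S) = n - hamming_weight n a"
    unfolding hamming_weight_def by (subst card_Diff_subset) auto
  then have "p \<le> card ({1..n} - ?S)" using p by simp
  then obtain V where V: "V \<subseteq> {1..n} - ?S" "card V = p" "finite V" by (meson obtain_subset_with_card_n)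
  obtain u where u: "bij_betw u {..<p} U" using U ex_bij_betw_nat_finite[of U] by (auto simp: atLeast0LessThan)
  obtain v where v: "bij_betw v {..<p} V" using V ex_bij_betw_nat_finite[of V] by (auto simp: atLeast0LessThan)
  have uS: "u i \<in> ?S" and vS: "v i \<in> {1..n} - ?S" if "i < p" for i
    using that u v U V by (auto simp: bij_betw_def)
  define G where "G = {t \<in> F. p \<le> t \<and> t + p \<le> n}"
  have G: "finite G" using F by (simp add: G_def)
  define Ps where "Ps = map (\<lambda>i. diff_factor (u i) (v i)) [0..<p]
    @ map (weight_factor n) (sorted_list_of_set G)"
  have affine: "P \<in> polys n \<and> total_degree P \<le> 1" if P: "P \<in> set Ps" for P
  proof -
    from P consider i where "i < p" "P = diff_factor (u i) (v i)" | t where "P = weight_factor n t"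
      by (auto simp: Ps_def)
    then show ?thesis
    proof cases
      case 1
      then have "u i \<in> {1..n}" "v i \<in> {1..n}" using uS[of i] vS[of i] by auto
      then show ?thesis unfolding 1(2) by (rule diff_factor_affine)
    qed (simp only: weight_factor_affine)
  qed
  have "total_degree (prod_list Ps) \<le> length Ps" using affine by (intro total_degree_prod_list) auto
  also have "length Ps \<le> d" using d by (simp add: Ps_def G_def)
  finally have "total_degree (prod_list Ps) \<le> d" .
  moreover have "prod_list Ps \<in> affine_products n"
    using affine by (auto simp: affine_products_def)
  moreover have "eval_poly (prod_list Ps) x = 0" if x: "x \<in> layers n F" for x
  proof (cases "hamming_weight n x \<in> G")
    case True
    then have "weight_factor n (hamming_weight n x) \<in> set Ps" using G by (simp add: Ps_def)
    moreover have "eval_poly (weight_factor n (hamming_weight n x)) x = 0"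
      using x by (simp add: eval_weight_factor layers_def)
    ultimately show ?thesis by (auto simp: eval_poly_prod_list prod_list_zero_iff intro: rev_image_eqI)
  next
    case False
    then have "\<not> (p \<le> hamming_weight n x \<and> hamming_weight n x + p \<le> n)"
      using x by (auto simp: G_def layers_def)
    moreover have "inj_on u {..<p}" "inj_on v {..<p}" "u ` {..<p} \<subseteq> {1..n}" "v ` {..<p} \<subseteq> {1..n}"
      "u ` {..<p} \<inter> v ` {..<p} = {}" using U V u v by (auto simp: bij_betw_def)
    moreover have "x \<in> cube n" using x by (simp add: layers_def)
    \<comment> \<open>An outer weight rules out that all \<open>p\<close> pairs are separated, so
      some pair has equal values and its difference vanishes.\<close>
    ultimately obtain i where "i < p" "x (u i) = x (v i)"
      using weight_bounds_of_pairs[of x n u p v] by metis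
    then have "diff_factor (u i) (v i) \<in> set Ps" "eval_poly (diff_factor (u i) (v i)) x = 0"
      by (auto simp: Ps_def)
    then show ?thesis by (auto simp: eval_poly_prod_list prod_list_zero_iff intro: rev_image_eqI)
  qed
  moreover have "eval_poly (prod_list Ps) a \<noteq> 0"
  proof -
    have "a (u i) - a (v i) \<noteq> 0" if "i < p" for i using uS[OF that] vS[OF that] by auto
    moreover have "hamming_weight n a \<notin> G" using a by (simp add: G_def)
    ultimately show ?thesis unfolding eval_poly_prod_list using G a
      by (auto simp: prod_list_zero_iff Ps_def eval_weight_factor)
  qed
  ultimately show ?thesis by blast
qed

subsection \<open>Averaging over layers\<close>

text \<open>Cube points are handled as subsets of \<open>{1..n}\<close>; the value
  \<open>undefined\<close> elsewhere matches the extensional encoding of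
  \<open>cube\<close>.\<close>

definition indicator_point :: "nat \<Rightarrow> nat set \<Rightarrow> nat \<Rightarrow> real" where
  "indicator_point n B i = (if i \<in> {1..n} then of_bool (i \<in> B) else undefined)"

lemma indicator_point_in_cube: "indicator_point n B \<in> cube n"
  by (auto simp: indicator_point_def cube_def PiE_iff extensional_def)

lemma hamming_weight_indicator_point:
  assumes "B \<subseteq> {1..n}"
  shows "hamming_weight n (indicator_point n B) = card B"
proof -
  have "{i \<in> {1..n}. indicator_point n B i = 1} = B"
    using assms by (auto simp: indicator_point_def)
  then show ?thesis by (simp add: hamming_weight_def)
qed

lemma cube_eq_indicator_point:
  assumes "a \<in> cube n"
  shows "a = indicator_point n {i \<in> {1..n}. a i = 1}"
proof
  fix i
  show "a i = indicator_point n {i \<in> {1..n}. a i = 1} i"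
  proof (cases "i \<in> {1..n}")
    case True
    then have "a i \<in> {0, 1}" using assms by (auto simp: cube_def PiE_iff)
    with True show ?thesis by (auto simp: indicator_point_def)
  next
    case False
    then show ?thesis using assms by (auto simp: indicator_point_def cube_def PiE_iff extensional_def)
  qed
qed

text \<open>Exponents on a support are positive and \<open>0\<close>, \<open>1\<close> are
  idempotent, so a monomial takes the value 1 if its support lies in \<open>B\<close> and 0
  otherwise. Averaging thus becomes counting sets that contain a given one.\<close>

lemma eval_poly_indicator_point:
  assumes P: "P \<in> polys n"
  shows "eval_poly P (indicator_point n B) =
    (\<Sum>m \<in> Poly_Mapping.keys P. Poly_Mapping.lookup P m * of_bool (Poly_Mapping.keys m \<subseteq> B))"
  unfolding eval_poly_def
proof (rule sum.cong, rule refl)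
  fix m assume "m \<in> Poly_Mapping.keys P"
  then have m: "Poly_Mapping.keys m \<subseteq> {1..n}" using P by (auto simp: polys_def)
  have "(\<Prod>i\<in>Poly_Mapping.keys m. indicator_point n B i ^ Poly_Mapping.lookup m i) =
      (\<Prod>i\<in>Poly_Mapping.keys m. of_bool (i \<in> B))"
  proof (rule prod.cong, rule refl)
    fix i assume i: "i \<in> Poly_Mapping.keys m"
    then have "indicator_point n B i = of_bool (i \<in> B)" using m by (auto simp: indicator_point_def)
    moreover have "Poly_Mapping.lookup m i \<noteq> 0" using i by (simp add: in_keys_iff)
    ultimately show "indicator_point n B i ^ Poly_Mapping.lookup m i = of_bool (i \<in> B)"
      by (simp add: zero_power)
  qed
  also have "\<dots> = of_bool (Poly_Mapping.keys m \<subseteq> B)"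
    by (cases "Poly_Mapping.keys m \<subseteq> B") (auto simp: subset_iff)
  finally show "Poly_Mapping.lookup P m * (\<Prod>i\<in>Poly_Mapping.keys m. indicator_point n B i ^ Poly_Mapping.lookup m i)
      = Poly_Mapping.lookup P m * of_bool (Poly_Mapping.keys m \<subseteq> B)" by simp
qed

lemma card_keys_le_total_degree:
  assumes "m \<in> Poly_Mapping.keys P"
  shows "card (Poly_Mapping.keys m) \<le> total_degree P"
proof -
  have "card (Poly_Mapping.keys m) = (\<Sum>i\<in>Poly_Mapping.keys m. 1)" by simp
  also have "\<dots> \<le> (\<Sum>i\<in>Poly_Mapping.keys m. Poly_Mapping.lookup m i)"
    by (rule sum_mono) (auto simp: in_keys_iff)
  also have "\<dots> \<le> total_degree P" using assms by (auto simp: total_degree_def)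
  finally show ?thesis .
qed

text \<open>The binomial coefficient \<open>v choose k\<close> as a polynomial in
  \<open>v\<close>.\<close>

definition choose_poly :: "nat \<Rightarrow> real poly" where
  "choose_poly k = smult (1 / fact k) (\<Prod>i\<in>{0..<k}. [:- of_nat i, 1:])"

lemma poly_choose_poly: "poly (choose_poly k) (real v) = real (v choose k)"
  by (simp add: choose_poly_def poly_prod binomial_gbinomial gbinomial_prod_rev)

lemma degree_choose_poly: "degree (choose_poly k) \<le> k"
  using degree_prod_sum_le[of "{0..<k}" "\<lambda>i. [:- real i, 1:]"] by (simp add: choose_poly_def)

text \<open>Deleting \<open>N\<close> is a bijection onto the subsets of \<open>U - N\<close> of
  size \<open>v - card N\<close>. For \<open>card N > v\<close> the truncated difference would
  wrongly count one set.\<close>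

lemma card_supersets_of_card:
  assumes "finite U" "N \<subseteq> U" "card N \<le> v"
  shows "card {B. B \<subseteq> U \<and> card B = v \<and> N \<subseteq> B} = (card U - card N) choose (v - card N)"
proof -
  have fN: "finite N" using assms finite_subset by blast
  have "bij_betw (\<lambda>B. B - N) {B. B \<subseteq> U \<and> card B = v \<and> N \<subseteq> B} {C. C \<subseteq> U - N \<and> card C = v - card N}"
  proof (rule bij_betw_byWitness[where f' = "\<lambda>C. C \<union> N"])
    show "(\<lambda>B. B - N) ` {B. B \<subseteq> U \<and> card B = v \<and> N \<subseteq> B} \<subseteq> {C. C \<subseteq> U - N \<and> card C = v - card N}"
      using fN by (auto simp: card_Diff_subset)
    show "(\<lambda>C. C \<union> N) ` {C. C \<subseteq> U - N \<and> card C = v - card N} \<subseteq> {B. B \<subseteq> U \<and> card B = v \<and> N \<subseteq> B}"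
    proof clarsimp
      fix C assume C: "C \<subseteq> U - N" "card C = v - card N"
      then have "finite C" using assms(1) finite_subset by blast
      then have "card (C \<union> N) = card C + card N" using C fN by (intro card_Un_disjoint) auto
      then show "C \<subseteq> U \<and> N \<subseteq> U \<and> card (C \<union> N) = v" using C assms by auto
    qed
  qed auto
  then have "card {B. B \<subseteq> U \<and> card B = v \<and> N \<subseteq> B} = card {C. C \<subseteq> U - N \<and> card C = v - card N}"
    by (rule bij_betw_same_card)
  also have "\<dots> = card (U - N) choose (v - card N)" using assms by (intro n_subsets) auto
  finally show ?thesis using assms fN by (simp add: card_Diff_subset)
qed

text \<open>With \<open>u = card U\<close> and \<open>k = card N\<close>, the identity \<open>(u
  choose v) * (v choose k) = (u choose k) * ((u - k) choose (v - k))\<close> rewrites the count so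
  that, apart from the factor \<open>u choose v\<close>, it depends on \<open>v\<close> only through
  \<open>v choose k\<close>.\<close>

lemma sum_of_bool_subset:
  assumes U: "finite U" and N: "finite N" and v: "v \<le> card U"
  shows "(\<Sum>B | B \<subseteq> U \<and> card B = v. of_bool (N \<subseteq> B)) =
    real (card U choose v) * (if N \<subseteq> U then real (v choose card N) / real (card U choose card N) else 0)"
proof -
  have "(\<Sum>B | B \<subseteq> U \<and> card B = v. of_bool (N \<subseteq> B) :: real) =
      real (card ({B. B \<subseteq> U \<and> card B = v} \<inter> {B. N \<subseteq> B}))"
    using U by (subst sum_of_bool_eq) (auto)
  also have "{B. B \<subseteq> U \<and> card B = v} \<inter> {B. N \<subseteq> B} = {B. B \<subseteq> U \<and> card B = v \<and> N \<subseteq> B}" by auto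
  finally have eq: "(\<Sum>B | B \<subseteq> U \<and> card B = v. of_bool (N \<subseteq> B) :: real) =
    real (card {B. B \<subseteq> U \<and> card B = v \<and> N \<subseteq> B})" .
  show ?thesis
  proof (cases "N \<subseteq> U \<and> card N \<le> v")
    case True
    then have le: "card N \<le> card U" using U card_mono by blast
    have "(card U choose v) * (v choose card N) = (card U choose card N) * ((card U - card N) choose (v - card N))"
      using True v by (intro choose_mult) auto
    then have "real (card U choose v) * real (v choose card N) =
        real (card U choose card N) * real ((card U - card N) choose (v - card N))"
      by (metis of_nat_mult)
    then show ?thesis using True le U
      by (simp add: eq card_supersets_of_card field_simps)
  next
    case False
    \<comment> \<open>No \<open>B\<close> qualifies, and the right-hand side is 0 too: either
      \<open>N\<close> is not contained in \<open>U\<close>, or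
      \<open>v choose card N = 0\<close>.\<close>
    have "B \<notin> {B. B \<subseteq> U \<and> card B = v \<and> N \<subseteq> B}" for B
    proof
      assume "B \<in> {B. B \<subseteq> U \<and> card B = v \<and> N \<subseteq> B}"
      then have B: "B \<subseteq> U" "N \<subseteq> B" "v = card B" by auto
      then have "card N \<le> card B" using U finite_subset by (intro card_mono) auto
      then show False using B False by auto
    qed
    then have "{B. B \<subseteq> U \<and> card B = v \<and> N \<subseteq> B} = {}" by blast
    then show ?thesis using False by (auto simp: eq binomial_eq_0)
  qed
qed

text \<open>After dividing by the number of sets \<open>B\<close>, each monomial \<open>m\<close> contributes, with
  \<open>k = card (keys m - A)\<close>, the ratio \<open>(v choose k) / (card U choose k)\<close>, a polynomial in \<open>v\<close> of degree \<open>k\<close>.\<close>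

lemma average_is_poly:
  assumes P: "P \<in> polys n" "total_degree P \<le> d" and U: "finite U"
  shows "\<exists>q. degree q \<le> d \<and> (\<forall>v \<le> card U.
    (\<Sum>B | B \<subseteq> U \<and> card B = v. eval_poly P (indicator_point n (A \<union> B))) = real (card U choose v) * poly q (real v))"
proof -
  let ?N = "\<lambda>m. Poly_Mapping.keys m - A"
  \<comment> \<open>A monomial whose support leaves \<open>A \<union> U\<close> vanishes at every
    point of the sum and gets coefficient 0.\<close>
  define q where "q = (\<Sum>m\<in>Poly_Mapping.keys P. smult
    (Poly_Mapping.lookup P m * (if ?N m \<subseteq> U then 1 / real (card U choose card (?N m)) else 0))
    (choose_poly (card (?N m))))"
  have "degree q \<le> d" unfolding q_def
  proof (rule degree_sum_le)
    fix m assume m: "m \<in> Poly_Mapping.keys P"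
    have "card (?N m) \<le> card (Poly_Mapping.keys m)" by (rule card_mono) auto
    also have "\<dots> \<le> d" using card_keys_le_total_degree[OF m] P by simp
    finally have "degree (choose_poly (card (?N m))) \<le> d" using degree_choose_poly order_trans by blast
    then show "degree (smult (Poly_Mapping.lookup P m * (if ?N m \<subseteq> U then 1 / real (card U choose card (?N m)) else 0))
    (choose_poly (card (?N m)))) \<le> d" using degree_smult_le order_trans by blast
  qed simp
  moreover have "(\<Sum>B | B \<subseteq> U \<and> card B = v. eval_poly P (indicator_point n (A \<union> B)))
      = real (card U choose v) * poly q (real v)" if v: "v \<le> card U" for v
  proof -
    have sub: "Poly_Mapping.keys m \<subseteq> A \<union> B \<longleftrightarrow> ?N m \<subseteq> B" for m :: "nat \<Rightarrow>\<^sub>0 nat" and B by auto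
    have "(\<Sum>B | B \<subseteq> U \<and> card B = v. eval_poly P (indicator_point n (A \<union> B))) =
      (\<Sum>m\<in>Poly_Mapping.keys P. Poly_Mapping.lookup P m * (\<Sum>B | B \<subseteq> U \<and> card B = v. of_bool (?N m \<subseteq> B)))"
      unfolding eval_poly_indicator_point[OF P(1)] sub by (subst sum.swap) (simp add: sum_distrib_left)
    also have "\<dots> = real (card U choose v) * poly q (real v)"
      unfolding q_def poly_sum sum_distrib_left[of "real (card U choose v)"]
    proof (rule sum.cong, rule refl)
      fix m assume "m \<in> Poly_Mapping.keys P"
      have "finite (?N m)" by simp
      from sum_of_bool_subset[OF U this v]
      show "Poly_Mapping.lookup P m * (\<Sum>B | B \<subseteq> U \<and> card B = v. of_bool (?N m \<subseteq> B)) =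
        real (card U choose v) * poly (smult
          (Poly_Mapping.lookup P m * (if ?N m \<subseteq> U then 1 / real (card U choose card (?N m)) else 0))
          (choose_poly (card (?N m)))) (real v)"
        by (simp add: poly_choose_poly)
    qed
    finally show ?thesis .
  qed
  ultimately show ?thesis by blast
qed

text \<open>The polynomial \<open>q\<close> of \<open>average_is_poly\<close> has degree at most
  \<open>d\<close> but vanishes on \<open>T\<close>, which has more than \<open>d\<close> elements,
  so \<open>q = 0\<close>. Its values on \<open>T\<close> can be read off because
  \<open>card U choose t\<close> is nonzero for \<open>t \<le> card U\<close>.\<close>

lemma average_vanishes:
  assumes P: "P \<in> polys n" "total_degree P \<le> d" and U: "finite U"
    and T: "T \<subseteq> {0..card U}" "d < card T"
    and zero: "\<And>B. B \<subseteq> U \<Longrightarrow> card B \<in> T \<Longrightarrow> eval_poly P (indicator_point n (A \<union> B)) = 0"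
    and v: "v \<le> card U"
  shows "(\<Sum>B | B \<subseteq> U \<and> card B = v. eval_poly P (indicator_point n (A \<union> B))) = 0"
proof -
  obtain q where q: "degree q \<le> d" "\<And>v. v \<le> card U \<Longrightarrow>
    (\<Sum>B | B \<subseteq> U \<and> card B = v. eval_poly P (indicator_point n (A \<union> B))) = real (card U choose v) * poly q (real v)"
    using average_is_poly[OF P U, of A] by blast
  have "poly q (real t) = 0" if t: "t \<in> T" for t
  proof -
    have "(\<Sum>B | B \<subseteq> U \<and> card B = t. eval_poly P (indicator_point n (A \<union> B))) = 0"
      using zero t by (intro sum.neutral) auto
    moreover have "t \<le> card U" using T t by auto
    ultimately show ?thesis using q(2)[of t] by simp
  qed
  then have sub: "real ` T \<subseteq> {x. poly q x = 0}" by auto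
  have "q = 0"
  proof (rule ccontr)
    assume "q \<noteq> 0"
    then have "card (real ` T) \<le> d"
      using card_mono[OF poly_roots_finite sub] card_poly_roots_bound[of q] q(1) by fastforce
    then show False using T by (simp add: card_image)
  qed
  then show ?thesis using q(2)[OF v] by simp
qed

text \<open>Sets \<open>A \<union> B\<close> are averaged with \<open>A\<close> the support of
  \<open>a\<close> and \<open>B\<close> in its complement; for \<open>v = 0\<close> the sum has the
  single term \<open>B = {}\<close>, which is the value at \<open>a\<close>.\<close>

lemma eval_poly_zero_below:
  assumes P: "P \<in> polys n" "total_degree P \<le> d" and E: "E \<subseteq> {0..n}"
    and zero: "\<And>x. x \<in> layers n E \<Longrightarrow> eval_poly P x = 0"
    and a: "a \<in> cube n" and d: "d < card {t \<in> E. hamming_weight n a \<le> t}"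
  shows "eval_poly P a = 0"
proof -
  define A where "A = {i \<in> {1..n}. a i = 1}"
  have aA: "a = indicator_point n A" using cube_eq_indicator_point[OF a] by (simp add: A_def)
  have cA: "card A = hamming_weight n a" by (simp add: A_def hamming_weight_def)
  have A: "A \<subseteq> {1..n}" "finite A" by (auto simp: A_def)
  define U where "U = {1..n} - A"
  have U: "finite U" "card U = n - card A" using A by (auto simp: U_def card_Diff_subset)
  \<comment> \<open>The size of \<open>B\<close> is the weight of \<open>A \<union> B\<close> minus
    \<open>card A\<close>; restricting to \<open>t\<close> at least \<open>card A\<close> keeps this
    shift injective.\<close>
  define T where "T = (\<lambda>t. t - card A) ` {t \<in> E. hamming_weight n a \<le> t}"
  have "inj_on (\<lambda>t. t - card A) {t \<in> E. hamming_weight n a \<le> t}" by (auto simp: inj_on_def cA)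
  then have cT: "d < card T" using d by (simp add: T_def card_image)
  have "(\<Sum>B | B \<subseteq> U \<and> card B = 0. eval_poly P (indicator_point n (A \<union> B))) = 0"
  proof (rule average_vanishes[OF P U(1) _ cT])
    show "T \<subseteq> {0..card U}" using E by (auto simp: T_def U)
    fix B assume B: "B \<subseteq> U" "card B \<in> T"
    have "finite B" using B U finite_subset by blast
    then have "card (A \<union> B) = card A + card B" using A B by (intro card_Un_disjoint) (auto simp: U_def)
    then have "card (A \<union> B) \<in> E" using B(2) by (auto simp: T_def cA)
    moreover have "A \<union> B \<subseteq> {1..n}" using A B by (auto simp: U_def)
    ultimately show "eval_poly P (indicator_point n (A \<union> B)) = 0"
      by (intro zero) (auto simp: layers_def indicator_point_in_cube hamming_weight_indicator_point)
  qed simp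
  moreover have "{B. B \<subseteq> U \<and> card B = 0} = {{}}" using U(1) by (auto simp: finite_subset)
  ultimately show ?thesis by (simp add: aA)
qed

text \<open>Dual average over subsets of the support \<open>U\<close> of \<open>a\<close>, with
  \<open>A = {}\<close>; for \<open>v = card U\<close> the only term is
  \<open>B = U\<close>.\<close>

lemma eval_poly_zero_above:
  assumes P: "P \<in> polys n" "total_degree P \<le> d"
    and zero: "\<And>x. x \<in> layers n E \<Longrightarrow> eval_poly P x = 0"
    and a: "a \<in> cube n" and d: "d < card {t \<in> E. t \<le> hamming_weight n a}"
  shows "eval_poly P a = 0"
proof -
  define U where "U = {i \<in> {1..n}. a i = 1}"
  have aU: "a = indicator_point n U" using cube_eq_indicator_point[OF a] by (simp add: U_def)
  have cU: "card U = hamming_weight n a" by (simp add: U_def hamming_weight_def)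
  have U: "U \<subseteq> {1..n}" "finite U" by (auto simp: U_def)
  have "(\<Sum>B | B \<subseteq> U \<and> card B = card U. eval_poly P (indicator_point n ({} \<union> B))) = 0"
  proof (rule average_vanishes[OF P U(2) _ d])
    fix B assume B: "B \<subseteq> U" "card B \<in> {t \<in> E. t \<le> hamming_weight n a}"
    then show "eval_poly P (indicator_point n ({} \<union> B)) = 0"
      using U by (intro zero) (auto simp: layers_def indicator_point_in_cube hamming_weight_indicator_point)
  qed (auto simp: cU)
  moreover have "{B. B \<subseteq> U \<and> card B = card U} = {U}" using card_subset_eq[OF U(2)] by auto
  ultimately show ?thesis by (simp add: aU)
qed

subsection \<open>The closures\<close>

text \<open>For a fixed \<open>P\<close> vanishing on the layers of \<open>E\<close>, the weights
  whose layers \<open>P\<close> kills contain \<open>E\<close> and absorb each step of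
  \<open>L\<close>: a weight adjoined by \<open>L\<close> has more than \<open>d\<close> killed
  weights on one side, so an averaging lemma applies.\<close>

lemma layers_L_bar_subset_Zcl:
  assumes E: "E \<subseteq> {0..n}"
  shows "layers n (L_bar n d E) \<subseteq> Zcl n d (layers n E)"
proof
  fix a assume a: "a \<in> layers n (L_bar n d E)"
  have "eval_poly P a = 0" if P: "P \<in> polys n" "total_degree P \<le> d"
    and zero: "\<forall>x\<in>layers n E. eval_poly P x = 0" for P
  proof -
    let ?Z = "{j. \<forall>x\<in>layers n {j}. eval_poly P x = 0}"
    have "L_bar n d E \<subseteq> ?Z"
    proof (rule L_bar_least[OF E])
      show "E \<subseteq> ?Z" using zero by (auto simp: layers_def)
    next
      fix F assume F: "F \<subseteq> {0..n}" "F \<subseteq> ?Z"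
      have F0: "eval_poly P x = 0" if "x \<in> layers n F" for x
        using that F(2) by (auto simp: layers_def)
      then have "eval_poly P x = 0" if "x \<in> cube n" "hamming_weight n x \<in> L n d F" for x
        using that eval_poly_zero_below[OF P F(1) F0, where a = x] eval_poly_zero_above[OF P F0, where a = x]
        by (auto simp: L_eq_card[OF F(1)] layers_def)
      then show "L n d F \<subseteq> ?Z" by (auto simp: layers_def)
    qed
    then show ?thesis using a by (auto simp: layers_def)
  qed
  then show "a \<in> Zcl n d (layers n E)" using a by (auto simp: Zcl_def layers_def)
qed

text \<open>A point outside is excluded by the affine product that separates it from the layers of
  \<open>L_bar n d E\<close>; closedness under \<open>L\<close> supplies the number \<open>p\<close>
  of pairs, and the product vanishes on the layers of \<open>E\<close> because \<open>E\<close> is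
  contained in \<open>L_bar n d E\<close>.\<close>

lemma hcl_subset_layers_L_bar:
  assumes E: "E \<subseteq> {0..n}"
  shows "hcl n d (layers n E) \<subseteq> layers n (L_bar n d E)"
proof
  fix a assume a: "a \<in> hcl n d (layers n E)"
  then have cube: "a \<in> cube n" by (simp add: hcl_def)
  show "a \<in> layers n (L_bar n d E)"
  proof (rule ccontr)
    assume "\<not> ?thesis"
    then have w: "hamming_weight n a \<notin> L_bar n d E" using cube by (simp add: layers_def)
    obtain p where p: "p \<le> hamming_weight n a" "hamming_weight n a + p \<le> n"
      "p + card {t \<in> L_bar n d E. p \<le> t \<and> t + p \<le> n} \<le> d"
      using gap_of_L_closed[OF L_bar_subset[OF E] L_L_bar[OF E] hamming_weight_le w] by blast
    have "finite (L_bar n d E)" using L_bar_subset[OF E] finite_subset by blast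
    then obtain P where P: "P \<in> affine_products n" "total_degree P \<le> d" "eval_poly P a \<noteq> 0"
      "\<forall>x\<in>layers n (L_bar n d E). eval_poly P x = 0"
      using affine_product_separates[OF _ cube w p] by blast
    then have "\<forall>x\<in>layers n E. eval_poly P x = 0" using subset_L_bar[of E n d] by (auto simp: layers_def)
    then show False using a P by (auto simp: hcl_def)
  qed
qed

lemma weights_layers: "F \<subseteq> {0..n} \<Longrightarrow> weights n (layers n F) = F"
  unfolding weights_def using bij_betw_layers by (intro the_inv_into_f_f) (auto simp: bij_betw_def)

lemma layers_subset_layers_iff:
  assumes "j \<le> n"
  shows "layers n {j} \<subseteq> layers n F \<longleftrightarrow> j \<in> F"
  using exists_point_of_weight[OF assms] by (auto simp: layers_def)

theorem theorem1p10:
  fixes n d :: nat and E :: "nat set"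
  assumes "n \<ge> 1" and "d \<in> {0..n}" and "E \<subseteq> {0..n}"
  shows "symmetric n (hcl n d (layers n E))
       \<and> symmetric n (Zcl n d (layers n E))
       \<and> hcl_wt n d E = hstar_cl n d E
       \<and> hstar_cl n d E = Zcl_wt n d E
       \<and> Zcl_wt n d E = Zstar_cl n d E
       \<and> Zstar_cl n d E = L_bar n d E"
proof -
  let ?F = "L_bar n d E"
  have sub: "?F \<subseteq> {0..n}" using L_bar_subset assms(3) .
  \<comment> \<open>The inclusions close up: the layers of \<open>?F\<close> lie in
    \<open>Zcl\<close>, which lies in \<open>hcl\<close>, which lies in the layers of
    \<open>?F\<close>.\<close>
  have Z: "Zcl n d (layers n E) = layers n ?F" and h: "hcl n d (layers n E) = layers n ?F"
    using layers_L_bar_subset_Zcl[OF assms(3)] hcl_subset_layers_L_bar[OF assms(3)] Zcl_subset_hcl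
    by blast+
  have "j \<in> {0..n} \<and> layers n {j} \<subseteq> layers n ?F \<longleftrightarrow> j \<in> ?F" for j
    using sub layers_subset_layers_iff[of j n ?F] by fastforce
  then have "{j \<in> {0..n}. layers n {j} \<subseteq> layers n ?F} = ?F" by blast
  then show ?thesis
    by (simp add: Z h symmetric_layers hcl_wt_def Zcl_wt_def hstar_cl_def Zstar_cl_def
        weights_layers[OF sub])
qed

end
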